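(* Let $m_1,m_2,\ldots$ be nonnegative integers with $m_1,m_2>0$ such that $M(z)=\sum_{i\ge1}m_iz^i/i!$ has strictly positive radius of convergence. Let $n,r$ be integers with $0<r<n/2$, put $k:=n-r$, and $$x:=\frac{2m_1r}{m_2(n-2r)},\qquad \rho:=\sup_{i\ge3}\Bigl(\frac{m_i}{i!}\Bigr)^{1/i},\qquad y:=\frac{2m_1m_3}{3m_2^2}\,\frac{r^2}{n-2r},$$ $$c_0:=\frac{e}{\sqrt{2\pi}},\qquad u_4(n,r):=k\,\frac{2\rho^4x^3}{m_1}\;2c_0\sqrt{2\pi r},\qquad z:=(e^y-1)+u_4(n,r).$$ Assume that $x\rho\le \tfrac12$ and $\dfrac{2k\rho^3x^2}{m_1}\le\tfrac12$. Pick an assembly uniformly from the $p(n,k)$ $M$-assemblies of size $n$ having exactly $k$ components, and let $L_1$ be the size of its largest component. Then $$\mathbb P(L_1\ge3)\le z .$$ Hence, in case $z<1$, $$\frac{n^{2r}\,m_1^{n-2r}\,m_2^r}{r!\,2^r}\;\le\;p(n,k)\;\le\;\frac{n^{2r}\,m_1^{n-2r}\,m_2^r}{r!\,2^r}\Bigl(1+\frac{z}{1-z}\Bigr).$$ Moreover, when $m_3>0$ and $r=o(\sqrt n)$ (as $n\to\infty$), the upper bound on the relative error satisfies $$\frac{z}{1-z}\sim z\sim y\sim\frac{2m_1m_3}{3m_2^2}\,\frac{r^2}{n}\asymp\frac{r^2}{n}.$$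
   Context: Given nonnegative integers $m_1,m_2,\ldots$ with exponential generating function $M(z)=\sum_{i\ge1}m_iz^i/i!$, an $M$-assembly of size $n$ is obtained by choosing a set partition of $\{1,\dots,n\}$ into nonempty blocks and, for each block of size $i$, choosing one of $m_i$ possible decorations. The decorated blocks are the components; the size of a component is the size of its block. $p(n,k)$ is the number of $M$-assemblies of size $n$ with exactly $k$ components; equivalently $\sum_{n,k\ge0}p(n,k)z^n\theta^k/n!=e^{\theta M(z)}$. $a_n\sim b_n$ means $a_n/b_n\to1$; $a_n\asymp b_n$ means $a_n/b_n$ is bounded away from $0$ and $\infty$. The radius of convergence of $M$ being positive is equivalent to $\rho<\infty$.
   Formalization: The factor n^{2r} in the bounds on p(n,k) is replaced by the falling factorial n(n-1)...(n-2r+1); with the ordinary power the lower bound fails, e.g. n=3, r=1, m_i=0 for i≥3, where z=0 and p(3,2)=3m_1m_2 < 4.5m_1m_2. *)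

theory Defs
  imports
    "HOL-Probability.Probability"
    "HOL-Library.Landau_Symbols"
    "HOL-Library.Disjoint_Sets"
    "HOL-Library.FuncSet"
begin

text \<open>
  Throughout, \<open>m i\<close> is the number of possible decorations of a block of size \<open>i \<ge> 1\<close>; the value
  \<open>m 0\<close> is never used.
\<close>

definition M_egf :: "(nat \<Rightarrow> nat) \<Rightarrow> real fps" where
  "M_egf m = Abs_fps (\<lambda>i. if i = 0 then 0 else real (m i) / fact i)"

text \<open>
  An assembly is a pair of a set partition of \<open>{1..n}\<close> and a function choosing, for each block
  of size \<open>i\<close>, one of the decorations \<open>0, \<dots>, m i - 1\<close>. The function is extensional, so
  that it carries no information beyond the blocks and finite cardinalities count assemblies.
\<close>

type_synonym assembly = "nat set set \<times> (nat set \<Rightarrow> nat)"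

definition assemblies :: "(nat \<Rightarrow> nat) \<Rightarrow> nat \<Rightarrow> assembly set" where
  "assemblies m n = {(P, d). partition_on {1..n} P \<and> d \<in> (\<Pi>\<^sub>E B\<in>P. {..<m (card B)})}"

definition num_components :: "assembly \<Rightarrow> nat" where
  "num_components a = card (fst a)"

definition largest_component :: "assembly \<Rightarrow> nat" where
  "largest_component a = Max (card ` fst a)"

definition assemblies_with :: "(nat \<Rightarrow> nat) \<Rightarrow> nat \<Rightarrow> nat \<Rightarrow> assembly set" where
  "assemblies_with m n k = {a \<in> assemblies m n. num_components a = k}"

definition p :: "(nat \<Rightarrow> nat) \<Rightarrow> nat \<Rightarrow> nat \<Rightarrow> nat" where
  "p m n k = card (assemblies_with m n k)"

definition falling :: "nat \<Rightarrow> nat \<Rightarrow> real" where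
  "falling n j = (\<Prod>i<j. real n - real i)"

definition x_par :: "(nat \<Rightarrow> nat) \<Rightarrow> nat \<Rightarrow> nat \<Rightarrow> real" where
  "x_par m n r = 2 * real (m 1) * real r / (real (m 2) * (real n - 2 * real r))"

text \<open>
  The supremum is a real one; the family is bounded above exactly when \<open>M_egf m\<close> has positive
  radius of convergence.
\<close>

definition \<rho> :: "(nat \<Rightarrow> nat) \<Rightarrow> real" where
  "\<rho> m = (SUP i\<in>{3..}. root i (real (m i) / fact i))"

definition y_par :: "(nat \<Rightarrow> nat) \<Rightarrow> nat \<Rightarrow> nat \<Rightarrow> real" where
  "y_par m n r = 2 * real (m 1) * real (m 3) / (3 * real (m 2) ^ 2)
     * (real r ^ 2 / (real n - 2 * real r))"

definition c0 :: real where
  "c0 = exp 1 / sqrt (2 * pi)"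

definition u4 :: "(nat \<Rightarrow> nat) \<Rightarrow> nat \<Rightarrow> nat \<Rightarrow> real" where
  "u4 m n r = real (n - r) * (2 * \<rho> m ^ 4 * x_par m n r ^ 3 / real (m 1))
     * (2 * c0 * sqrt (2 * pi * real r))"

definition z_par :: "(nat \<Rightarrow> nat) \<Rightarrow> nat \<Rightarrow> nat \<Rightarrow> real" where
  "z_par m n r = (exp (y_par m n r) - 1) + u4 m n r"

text \<open>
  The number of assemblies of size \<open>n\<close> with \<open>r\<close> components of size 2 and all others of size 1.
  The factor is the falling factorial \<open>n (n - 1) \<cdots> (n - 2 r + 1)\<close>, not the power \<open>n ^ (2 r)\<close>.
\<close>

definition main_term :: "(nat \<Rightarrow> nat) \<Rightarrow> nat \<Rightarrow> nat \<Rightarrow> real" where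
  "main_term m n r = falling n (2 * r) * real (m 1) ^ (n - 2 * r) * real (m 2) ^ r
     / (fact r * 2 ^ r)"

end

theory Submission
  imports Defs
begin

text \<open>
  Marking a component shows that \<open>k! p(n,k) = n! [z^n] M(z)^k\<close>. With \<open>N = n - 2r\<close> write
  \<open>M(z) = z (m\<^sub>1 + m\<^sub>2 z / 2 + R(z))\<close>, where \<open>R\<close> collects the components of size at least 3.
  Expanding the \<open>k\<close>-th power in powers of \<open>R\<close>, the term without \<open>R\<close> is the main term, and comparing
  multinomial coefficients bounds the contribution of \<open>R^s\<close> relative to it by
  \<open>(N R(x) / m\<^sub>1)^s / s!\<close>. Hence \<open>p(n,k)\<close> is at most \<open>exp (N R(x) / m\<^sub>1)\<close> times the main term.
  The \<open>z^2\<close> coefficient of \<open>R\<close> contributes exactly \<open>y\<close> to the exponent, and the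
  remaining ones at most \<open>W = 2 N \<rho>^4 x^3 / m\<^sub>1\<close>, a quantity that \<open>u\<^sub>4\<close> exceeds by a factor of at
  least \<open>2e\<close>. As \<open>y, W \<le> 1/4\<close>, this gives \<open>exp (y + W) \<le> 1 + z\<close>.
\<close>

subsection \<open>Counting assemblies by power series coefficients\<close>

text \<open>An arbitrary ground set replaces \<open>{1..n}\<close> because deleting a block leaves a
  ground set that is no longer an initial segment, and the recursion on the number of components
  works by such deletions.\<close>

definition assemblies_on :: "(nat \<Rightarrow> nat) \<Rightarrow> nat set \<Rightarrow> nat \<Rightarrow> assembly set" where
  "assemblies_on m A k =
     {(P, d). partition_on A P \<and> d \<in> (\<Pi>\<^sub>E B\<in>P. {..<m (card B)}) \<and> card P = k}"

lemma assemblies_with_eq: "assemblies_with m n k = assemblies_on m {1..n} k"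
  by (auto simp: assemblies_with_def assemblies_on_def assemblies_def num_components_def)

lemma finite_assemblies_on:
  assumes "finite A"
  shows "finite (assemblies_on m A k)"
proof (rule finite_subset)
  show "assemblies_on m A k \<subseteq>
      (SIGMA P:{P. partition_on A P}. \<Pi>\<^sub>E B\<in>P. {..<m (card B)})"
    by (auto simp: assemblies_on_def)
  show "finite (SIGMA P:{P. partition_on A P}. \<Pi>\<^sub>E B\<in>P. {..<m (card B)})"
    using assms
    by (intro finite_SigmaI finitely_many_partition_on finite_PiE)
       (auto intro: finite_elements)
qed

text \<open>Removing \<open>B\<close> and recording its decoration separately is a bijection. Its
  inverse \<open>f\<close> puts the block back. Since decorations are extensional functions,
  \<open>g\<close> has to restrict \<open>d\<close> to the remaining blocks.\<close>

lemma card_assemblies_on_containing: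
  assumes A: "finite A" and B: "B \<subseteq> A" "B \<noteq> {}"
  shows "card {a \<in> assemblies_on m A (Suc k). B \<in> fst a} =
           m (card B) * card (assemblies_on m (A - B) k)"
proof -
  define f where "f = (\<lambda>(c::nat, (P::nat set set, d::nat set \<Rightarrow> nat)). (insert B P, d(B := c)))"
  define g where "g = (\<lambda>(P::nat set set, d::nat set \<Rightarrow> nat). (d B, (P - {B}, restrict d (P - {B}))))"
  let ?S = "{..<m (card B)} \<times> assemblies_on m (A - B) k"
  let ?T = "{a \<in> assemblies_on m A (Suc k). B \<in> fst a}"
  have new: "B \<notin> P" "disjnt B (\<Union>P)" "finite P" if "partition_on (A - B) P" for P
  proof -
    have "\<Union>P = A - B" using that by (auto dest: partition_onD1)
    with B show "B \<notin> P" "disjnt B (\<Union>P)" by (auto simp: disjnt_def)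
    show "finite P" using that A by (auto intro: finite_elements)
  qed
  have "bij_betw f ?S ?T"
  proof (rule bij_betw_byWitness[where f' = g])
    show "\<forall>s\<in>?S. g (f s) = s"
    proof
      fix s assume "s \<in> ?S"
      then obtain c P d where s: "s = (c, P, d)" and P: "partition_on (A - B) P"
        and d: "d \<in> (\<Pi>\<^sub>E B\<in>P. {..<m (card B)})"
        by (auto simp: assemblies_on_def)
      have "restrict (d(B := c)) P = d"
      proof
        fix C show "restrict (d(B := c)) P C = d C"
          using new(1)[OF P] PiE_arb[OF d, of C] by (cases "C \<in> P") auto
      qed
      with new(1)[OF P] show "g (f s) = s"
        by (simp add: s f_def g_def)
    qed
    show "\<forall>t\<in>?T. f (g t) = t"
    proof
      fix t assume "t \<in> ?T"
      then obtain P d where t: "t = (P, d)" and BP: "B \<in> P"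
        and d: "d \<in> (\<Pi>\<^sub>E B\<in>P. {..<m (card B)})"
        by (auto simp: assemblies_on_def)
      have "(restrict d (P - {B}))(B := d B) = d"
      proof
        fix C show "((restrict d (P - {B}))(B := d B)) C = d C"
          using BP PiE_arb[OF d, of C] by (cases "C \<in> P") auto
      qed
      with BP show "f (g t) = t" by (auto simp: t f_def g_def)
    qed
    show "f ` ?S \<subseteq> ?T"
    proof
      fix t assume "t \<in> f ` ?S"
      then obtain c P d where c: "c < m (card B)" and t: "t = (insert B P, d(B := c))"
        and P: "partition_on (A - B) P" "card P = k"
        and d: "d \<in> (\<Pi>\<^sub>E B\<in>P. {..<m (card B)})"
        by (auto simp: assemblies_on_def f_def)
      have "partition_on A (insert B P)"
        using partition_on_insert[OF new(2)[OF P(1)]] P B by auto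
      moreover have "d(B := c) \<in> (\<Pi>\<^sub>E B\<in>insert B P. {..<m (card B)})"
        using d c by (auto simp: PiE_def extensional_def)
      ultimately show "t \<in> ?T" using new[OF P(1)] P by (simp add: t assemblies_on_def)
    qed
    show "g ` ?T \<subseteq> ?S"
    proof
      fix s assume "s \<in> g ` ?T"
      then obtain P d where s: "s = (d B, P - {B}, restrict d (P - {B}))" and BP: "B \<in> P"
        and P: "partition_on A P" "card P = Suc k"
        and d: "d \<in> (\<Pi>\<^sub>E B\<in>P. {..<m (card B)})"
        by (auto simp: assemblies_on_def g_def)
      have "disjnt B (\<Union>(P - {B}))"
        using partition_onD2[OF P(1)] BP by (auto simp: disjnt_def disjoint_def)
      then have "partition_on (A - B) (P - {B})"
        using partition_on_insert[of B "P - {B}" A] P(1) BP by (auto simp: insert_absorb)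
      moreover have "d B < m (card B)" using d BP by auto
      moreover have "restrict d (P - {B}) \<in> (\<Pi>\<^sub>E B\<in>P - {B}. {..<m (card B)})"
        using d by auto
      ultimately show "s \<in> ?S" using P BP by (simp add: s assemblies_on_def)
    qed
  qed
  then have "card ?S = card ?T" by (rule bij_betw_same_card)
  then show ?thesis by (simp add: card_cartesian_product)
qed

lemma sum_Pow_card:
  assumes "finite A"
  shows "(\<Sum>B\<in>Pow A. f (card B)) = (\<Sum>i=0..card A. of_nat (card A choose i) * f i :: real)"
proof -
  have "(\<Sum>i=0..card A. of_nat (card A choose i) * f i) =
        (\<Sum>i=0..card A. \<Sum>B\<in>{B \<in> Pow A. card B = i}. f (card B))"
    using n_subsets[OF assms] by (intro sum.cong) auto
  also have "\<dots> = (\<Sum>B\<in>Pow A. f (card B))"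
    using assms by (intro sum.group) (auto intro: card_mono)
  finally show ?thesis by simp
qed

text \<open>Both sides count pairs of an assembly and a marked component, first by the assembly and
  then by the marked block.\<close>

lemma Suc_mult_card_assemblies_on:
  assumes "finite A"
  shows "Suc k * card (assemblies_on m A (Suc k)) =
           (\<Sum>B\<in>Pow A - {{}}. m (card B) * card (assemblies_on m (A - B) k))"
proof -
  let ?T = "assemblies_on m A (Suc k)"
  have fin: "finite ?T" using assms by (rule finite_assemblies_on)
  have "Suc k * card ?T = (\<Sum>a\<in>?T. card (fst a))"
    by (simp add: assemblies_on_def case_prod_unfold)
  also have "\<dots> = (\<Sum>a\<in>?T. card {B \<in> Pow A - {{}}. B \<in> fst a})"
    by (intro sum.cong arg_cong[where f = card])
       (auto simp: assemblies_on_def partition_on_def)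
  also have "\<dots> = (\<Sum>B\<in>Pow A - {{}}. card {a \<in> ?T. B \<in> fst a})"
    using fin assms by (intro sum_multicount_gen) auto
  also have "\<dots> = (\<Sum>B\<in>Pow A - {{}}. m (card B) * card (assemblies_on m (A - B) k))"
    using assms by (intro sum.cong card_assemblies_on_containing) auto
  finally show ?thesis .
qed

text \<open>Induction on \<open>k\<close> over all ground sets at once. Grouping the marked blocks
  by size turns the recurrence into a binomial convolution, which after division by factorials is
  the Cauchy product of \<open>M_egf m\<close> and its \<open>k\<close>-th power.\<close>

lemma card_assemblies_on:
  assumes "finite A"
  shows "fact k * real (card (assemblies_on m A k)) = fact (card A) * fps_nth (M_egf m ^ k) (card A)"
  using assms
proof (induction k arbitrary: A)
  case 0
  have "assemblies_on m A 0 = (if A = {} then {({}, \<lambda>_. undefined)} else {})"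
  proof -
    have "P = {}" if "partition_on A P" "card P = 0" for P
      using that finite_elements[OF 0 that(1)] by simp
    then show ?thesis
      by (auto simp: assemblies_on_def partition_on_def)
  qed
  with 0 show ?case by simp
next
  case (Suc k)
  let ?n = "card A"
  \<comment> \<open>\<open>m 0\<close> is arbitrary while \<open>M_egf m\<close> has constant
    coefficient 0. Forcing the value 0 here lets the empty block join the sum later at no
    cost.\<close>
  let ?c = "\<lambda>i. real (if i = 0 then 0 else m i)"
  let ?h = "\<lambda>i. ?c i * (fact (?n - i) * fps_nth (M_egf m ^ k) (?n - i))"
  have "fact (Suc k) * real (card (assemblies_on m A (Suc k))) =
        fact k * real (Suc k * card (assemblies_on m A (Suc k)))"
    by (simp add: algebra_simps)
  also have "\<dots> = (\<Sum>B\<in>Pow A - {{}}.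
      real (m (card B)) * (fact k * real (card (assemblies_on m (A - B) k))))"
    unfolding Suc_mult_card_assemblies_on[OF Suc.prems]
    by (simp add: sum_distrib_left algebra_simps)
  also have "\<dots> = (\<Sum>B\<in>Pow A - {{}}. ?h (card B))"
  proof (rule sum.cong)
    fix B assume B: "B \<in> Pow A - {{}}"
    then have "finite B" "card (A - B) = ?n - card B"
      using Suc.prems by (auto intro: finite_subset card_Diff_subset)
    moreover from this B have "card B \<noteq> 0" by auto
    ultimately show "real (m (card B)) * (fact k * real (card (assemblies_on m (A - B) k))) = ?h (card B)"
      using Suc.IH[of "A - B"] Suc.prems by simp
  qed simp
  also have "\<dots> = (\<Sum>B\<in>Pow A. ?h (card B))"
    using Suc.prems by (intro sum.mono_neutral_left) auto
  also have "\<dots> = (\<Sum>i=0..?n. real (?n choose i) * ?h i)"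
    using Suc.prems by (rule sum_Pow_card)
  also have "\<dots> = (\<Sum>i=0..?n. fact ?n * (fps_nth (M_egf m) i * fps_nth (M_egf m ^ k) (?n - i)))"
    by (intro sum.cong) (auto simp: M_egf_def binomial_fact)
  also have "\<dots> = fact ?n * fps_nth (M_egf m ^ Suc k) ?n"
    by (simp add: fps_mult_nth sum_distrib_left)
  finally show ?case .
qed

lemma fact_mult_p: "fact k * real (p m n k) = fact n * fps_nth (M_egf m ^ k) n"
  using card_assemblies_on[of "{1..n}" k m] by (simp add: p_def assemblies_with_eq)

section \<open>Assemblies without large components\<close>

text \<open>A block without admissible decorations cannot occur, so the event that no component has
  size at least 3 becomes a full set of assemblies for another weight sequence, and the same
  coefficient formula counts it.\<close>

definition trunc_decorations :: "(nat \<Rightarrow> nat) \<Rightarrow> nat \<Rightarrow> nat" where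
  "trunc_decorations m i = (if i \<le> 2 then m i else 0)"

text \<open>For \<open>n > 0\<close> the partition has a block, so the \<open>Max\<close> in
  \<open>largest_component\<close> is taken over a nonempty set and is at most 2 exactly when every
  block is.\<close>

lemma assemblies_with_trunc_decorations:
  assumes "n > 0"
  shows "assemblies_with (trunc_decorations m) n k =
           {a \<in> assemblies_with m n k. \<not> largest_component a \<ge> 3}"
proof -
  have "(\<forall>B\<in>P. d B < trunc_decorations m (card B)) \<longleftrightarrow>
        (\<forall>B\<in>P. d B < m (card B)) \<and> \<not> Max (card ` P) \<ge> 3"
    if P: "partition_on {1..n} P" for P and d :: "nat set \<Rightarrow> nat"
  proof -
    have "finite P" using P by (auto intro: finite_elements)
    moreover have "P \<noteq> {}" using P assms by (auto simp: partition_on_def)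
    ultimately have "\<not> Max (card ` P) \<ge> 3 \<longleftrightarrow> (\<forall>B\<in>P. card B \<le> 2)"
      by (subst Max_ge_iff) force+
    then show ?thesis by (auto simp: trunc_decorations_def split: if_splits)
  qed
  then have "(P, d) \<in> assemblies_with (trunc_decorations m) n k \<longleftrightarrow>
      (P, d) \<in> assemblies_with m n k \<and> \<not> largest_component (P, d) \<ge> 3" for P d
    unfolding assemblies_with_def assemblies_def largest_component_def PiE_iff
    by (simp del: One_nat_def) blast
  then show ?thesis by (auto simp del: not_le)
qed

subsection \<open>Coefficients of powers of perturbed linear series\<close>

text \<open>The truncated sum of the product runs over the triangle \<open>i + j \<le> n\<close>,
  which lies in the square \<open>{..n} \<times> {..n}\<close>, and all terms are nonnegative.
  Working with truncations avoids any question of convergence at \<open>x\<close>.\<close>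

lemma partial_sum_fps_mult_le:
  fixes f g :: "real fps"
  assumes nonneg: "\<And>i. 0 \<le> fps_nth f i" "\<And>i. 0 \<le> fps_nth g i" "0 \<le> x"
    and F: "(\<Sum>i\<le>n. fps_nth f i * x ^ i) \<le> F"
    and G: "(\<Sum>i\<le>n. fps_nth g i * x ^ i) \<le> G"
  shows "(\<Sum>i\<le>n. fps_nth (f * g) i * x ^ i) \<le> F * G"
proof -
  have "(\<Sum>i\<le>n. fps_nth (f * g) i * x ^ i) =
      (\<Sum>i\<le>n. \<Sum>j\<le>i. (fps_nth f j * x ^ j) * (fps_nth g (i - j) * x ^ (i - j)))"
    unfolding fps_mult_nth sum_distrib_right atLeast0AtMost
  proof (intro sum.cong refl)
    fix i j :: nat assume "j \<in> {..i}"
    then have "x ^ i = x ^ j * x ^ (i - j)" by (simp flip: power_add)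
    then show "fps_nth f j * fps_nth g (i - j) * x ^ i =
        (fps_nth f j * x ^ j) * (fps_nth g (i - j) * x ^ (i - j))" by simp
  qed
  also have "\<dots> = (\<Sum>(i, j)\<in>{(i, j). i + j \<le> n}. (fps_nth f i * x ^ i) * (fps_nth g j * x ^ j))"
    by (rule sum.triangle_reindex_eq[symmetric])
  also have "\<dots> \<le> (\<Sum>(i, j)\<in>{..n} \<times> {..n}. (fps_nth f i * x ^ i) * (fps_nth g j * x ^ j))"
    using nonneg by (intro sum_mono2) auto
  also have "\<dots> = (\<Sum>i\<le>n. fps_nth f i * x ^ i) * (\<Sum>j\<le>n. fps_nth g j * x ^ j)"
    by (simp add: sum_product sum.cartesian_product)
  also have "\<dots> \<le> F * G"
    using F G nonneg by (intro mult_mono) (auto intro!: sum_nonneg order_trans[OF _ F])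
  finally show ?thesis .
qed

lemma fps_power_nonneg:
  fixes f :: "real fps"
  assumes "\<And>i. 0 \<le> fps_nth f i"
  shows "0 \<le> fps_nth (f ^ s) i"
  using assms
  by (induction s arbitrary: i) (auto simp: fps_one_nth fps_mult_nth intro!: sum_nonneg)

lemma partial_sum_fps_power_le:
  fixes f :: "real fps"
  assumes nonneg: "\<And>i. 0 \<le> fps_nth f i" "0 \<le> x"
    and F: "(\<Sum>i\<le>n. fps_nth f i * x ^ i) \<le> F"
  shows "(\<Sum>i\<le>n. fps_nth (f ^ s) i * x ^ i) \<le> F ^ s"
proof (induction s)
  case 0
  have "(\<Sum>i\<le>n. fps_nth 1 i * x ^ i) = (\<Sum>i\<le>n. if i = 0 then 1 else 0 :: real)"
    by (intro sum.cong) (auto simp: fps_one_nth)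
  then show ?case by simp
next
  case (Suc s)
  then show ?case
    using partial_sum_fps_mult_le[OF nonneg(1) fps_power_nonneg[OF nonneg(1)] nonneg(2) F] by simp
qed

lemma fps_nth_linear_power:
  fixes c d :: real
  shows "fps_nth ((fps_const c + fps_const d * fps_X) ^ l) j =
           of_nat (l choose j) * d ^ j * c ^ (l - j)"
proof -
  have "fps_nth ((fps_const d * fps_X + fps_const c) ^ l) j =
      (\<Sum>i\<le>l. fps_nth (of_nat (l choose i) * (fps_const d * fps_X) ^ i * fps_const c ^ (l - i)) j)"
    by (simp add: binomial_ring fps_sum_nth)
  also have "\<dots> = (\<Sum>i\<le>l. if i = j then of_nat (l choose j) * d ^ j * c ^ (l - j) else 0)"
  proof (intro sum.cong refl)
    fix i
    have "of_nat (l choose i) * (fps_const d * fps_X) ^ i * fps_const c ^ (l - i) =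
        fps_const (of_nat (l choose i) * d ^ i * c ^ (l - i)) * fps_X ^ i"
      by (simp add: power_mult_distrib fps_const_power fps_of_nat[symmetric] mult_ac
          flip: fps_const_mult)
    then show "fps_nth (of_nat (l choose i) * (fps_const d * fps_X) ^ i * fps_const c ^ (l - i)) j =
        (if i = j then of_nat (l choose j) * d ^ j * c ^ (l - j) else 0)"
      by (auto simp: fps_X_power_nth)
  qed
  \<comment> \<open>For \<open>j > l\<close> no index of the sum equals \<open>j\<close>, and the
    right-hand side is 0 as well because the binomial coefficient vanishes.\<close>
  also have "\<dots> = of_nat (l choose j) * d ^ j * c ^ (l - j)"
    by (simp add: binomial_eq_0)
  finally show ?thesis by (simp add: add.commute)
qed

lemma fact_mult_power_le_fact_add: "fact n * n ^ j \<le> (fact (n + j) :: nat)"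
proof (induction j)
  case (Suc j)
  have "fact n * n ^ Suc j = n * (fact n * n ^ j)" by simp
  also have "\<dots> \<le> Suc (n + j) * fact (n + j)" using Suc by (intro mult_mono) auto
  finally show ?case by simp
qed simp

lemma fact_le_power_mult_fact_diff:
  assumes "t \<le> r"
  shows "(fact r :: nat) \<le> r ^ t * fact (r - t)"
  using assms
proof (induction t)
  case (Suc t)
  have "r - t = Suc (r - Suc t)" using Suc.prems by simp
  then have "fact (r - t) = (r - t) * fact (r - Suc t)" by (metis fact_Suc of_nat_id)
  with Suc have "fact r \<le> r ^ t * ((r - t) * fact (r - Suc t))" by simp
  also have "\<dots> \<le> r ^ t * (r * fact (r - Suc t))" by (intro mult_mono) auto
  finally show ?case by (simp add: mult_ac)
qed simp

text \<open>Up to the common factor \<open>k!\<close>, the left product of binomials with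
  \<open>fact s\<close> is \<open>1 / ((r - t)! (N + t - s)!)\<close>, and \<open>k choose r\<close>
  is \<open>1 / (r! N!)\<close>. It remains to use \<open>r! \<le> r^t (r - t)!\<close> and
  \<open>N! N^(t - s) \<le> (N + t - s)!\<close>.\<close>

lemma choose_choose_le:
  fixes k r s t N :: nat
  assumes k: "k = N + r" and "s \<le> t" "t \<le> r"
  shows "(k choose s) * ((k - s) choose (r - t)) * fact s * N ^ (t - s) \<le> (k choose r) * r ^ t"
proof -
  let ?L = "(k choose s) * ((k - s) choose (r - t)) * fact s"
  have "?L * (fact (r - t) * fact (N + (t - s))) = fact k"
  proof -
    have e: "k - s - (r - t) = N + (t - s)" using assms by simp
    have "fact s * fact (k - s) * (k choose s) = fact k"
      using assms by (intro binomial_fact_lemma) auto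
    moreover have "fact (r - t) * fact (N + (t - s)) * ((k - s) choose (r - t)) = fact (k - s)"
      using assms binomial_fact_lemma[of "r - t" "k - s"] by (simp add: e)
    ultimately show ?thesis by (metis mult.assoc mult.commute)
  qed
  moreover have "(k choose r) * (fact r * fact N) = fact k"
    using binomial_fact_lemma[of r k] k by (simp add: mult_ac)
  ultimately have eq: "?L * (fact (r - t) * fact (N + (t - s))) = (k choose r) * (fact r * fact N)"
    by simp
  have "?L * N ^ (t - s) * (fact (r - t) * fact N) = ?L * (fact (r - t) * (fact N * N ^ (t - s)))"
    by (simp add: mult_ac)
  also have "\<dots> \<le> ?L * (fact (r - t) * fact (N + (t - s)))"
    by (intro mult_left_mono fact_mult_power_le_fact_add) auto
  also have "\<dots> = (k choose r) * (fact r * fact N)" by (rule eq)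
  also have "\<dots> \<le> (k choose r) * ((r ^ t * fact (r - t)) * fact N)"
    using assms by (intro mult_left_mono mult_right_mono fact_le_power_mult_fact_diff) auto
  also have "\<dots> = (k choose r) * r ^ t * (fact (r - t) * fact N)" by (simp add: mult_ac)
  finally show ?thesis by simp
qed

text \<open>Expand in powers of \<open>R\<close>. Compared with the term free of \<open>R\<close>,
  taking \<open>s\<close> factors from \<open>R\<close> with total degree \<open>t\<close> costs at
  most \<open>(N / c)^s / s!\<close> times \<open>x^t\<close>; this dictates the choice of
  \<open>x\<close>. Summing over \<open>t\<close> gives at most \<open>T^s\<close>, and summing over
  \<open>s\<close> gives a partial sum of the exponential series.\<close>

lemma fps_nth_power_linear_plus_le:
  fixes c d T :: real and R :: "real fps" and k r N :: nat
  defines "x \<equiv> c * real r / (d * real N)"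
  assumes c: "c > 0" and d: "d > 0" and N: "N > 0" and k: "k = N + r"
    and R: "\<And>i. 0 \<le> fps_nth R i" "fps_nth R 0 = 0"
    and T: "(\<Sum>i\<le>r. fps_nth R i * x ^ i) \<le> T"
  shows "fps_nth ((R + (fps_const c + fps_const d * fps_X)) ^ k) r \<le>
           real (k choose r) * c ^ N * d ^ r * exp (T * real N / c)"
proof -
  define G where "G = fps_const c + fps_const d * fps_X"
  let ?B = "real (k choose r) * c ^ N * d ^ r"
  have x: "x \<ge> 0" using c d by (simp add: x_def)
  have T0: "T \<ge> 0" using T by (rule order_trans[rotated]) (intro sum_nonneg mult_nonneg_nonneg R zero_le_power x)
  \<comment> \<open>\<open>R\<close> has no constant term, so only \<open>s \<le> t\<close>
    contributes; there the natural subtraction \<open>t - s\<close> is a true difference.\<close>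
  have Rs0: "fps_nth (R ^ s) t = 0" if "t < s" for s t
    using startsby_zero_power_prefix[OF R(2), of s] that by simp
  have bound: "real (k choose s) * (fps_nth (R ^ s) t * fps_nth (G ^ (k - s)) (r - t)) \<le>
      ?B * ((real N / c) ^ s / fact s * (fps_nth (R ^ s) t * x ^ t))" if "t \<le> r" for s t
  proof (cases "t < s")
    case True
    then show ?thesis by (simp add: Rs0)
  next
    case False
    then have st: "s \<le> t" by simp
    have "real ((k choose s) * ((k - s) choose (r - t)) * fact s * N ^ (t - s)) \<le> real ((k choose r) * r ^ t)"
      using choose_choose_le[OF k st \<open>t \<le> r\<close>] by (rule of_nat_mono)
    then have 1: "real (k choose s) * real ((k - s) choose (r - t)) * fact s * real N ^ (t - s)
        \<le> real (k choose r) * real r ^ t" by (simp only: of_nat_mult of_nat_power of_nat_fact)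
    have cN: "c ^ (k - s - (r - t)) = c ^ N * c ^ (t - s)"
      using st \<open>t \<le> r\<close> k by (simp flip: power_add)
    have dr: "d ^ r = d ^ (r - t) * d ^ t" using \<open>t \<le> r\<close> by (simp flip: power_add)
    have ct: "c ^ t = c ^ (t - s) * c ^ s" using st by (simp flip: power_add)
    have Nt: "real N ^ t = real N ^ (t - s) * real N ^ s" using st by (simp flip: power_add)
    have "real (k choose s) * (real ((k - s) choose (r - t)) * d ^ (r - t) * c ^ (k - s - (r - t))) =
        (real (k choose s) * real ((k - s) choose (r - t)) * fact s * real N ^ (t - s))
          * (d ^ (r - t) * c ^ N * c ^ (t - s) / (fact s * real N ^ (t - s)))"
      using N by (simp add: cN del: diff_diff_left)
    also have "\<dots> \<le> (real (k choose r) * real r ^ t)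
          * (d ^ (r - t) * c ^ N * c ^ (t - s) / (fact s * real N ^ (t - s)))"
      using 1 c d by (intro mult_right_mono) auto
    \<comment> \<open>Here \<open>(c / N)^(t - s) = (c / N)^t (N / c)^s\<close>, and
      \<open>(c / N)^t\<close> combines with \<open>r^t\<close> and \<open>d^(-t)\<close> to
      \<open>x^t\<close>.\<close>
    also have "\<dots> = ?B * ((real N / c) ^ s / fact s * x ^ t)"
      using c d N by (simp add: x_def dr ct Nt power_divide power_mult_distrib field_simps)
    finally have "real (k choose s) * fps_nth (G ^ (k - s)) (r - t) \<le>
        ?B * ((real N / c) ^ s / fact s * x ^ t)"
      by (simp add: G_def fps_nth_linear_power)
    from mult_left_mono[OF this fps_power_nonneg[OF R(1), where s = s and i = t]]
    show ?thesis by (simp add: mult_ac)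
  qed
  have "fps_nth ((R + G) ^ k) r = (\<Sum>s\<le>k. fps_nth (of_nat (k choose s) * (R ^ s * G ^ (k - s))) r)"
    by (simp add: binomial_ring fps_sum_nth mult.assoc)
  also have "\<dots> = (\<Sum>s\<le>k. real (k choose s) * fps_nth (R ^ s * G ^ (k - s)) r)"
    by (simp flip: fps_of_nat)
  also have "\<dots> = (\<Sum>s\<le>k. \<Sum>t\<le>r. real (k choose s) * (fps_nth (R ^ s) t * fps_nth (G ^ (k - s)) (r - t)))"
    by (simp only: fps_mult_nth sum_distrib_left atLeast0AtMost)
  also have "\<dots> \<le> (\<Sum>s\<le>k. \<Sum>t\<le>r. ?B * ((real N / c) ^ s / fact s * (fps_nth (R ^ s) t * x ^ t)))"
    by (intro sum_mono bound) auto
  also have "\<dots> = ?B * (\<Sum>s\<le>k. (real N / c) ^ s / fact s * (\<Sum>t\<le>r. fps_nth (R ^ s) t * x ^ t))"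
    by (simp only: sum_distrib_left)
  also have "\<dots> \<le> ?B * (\<Sum>s\<le>k. (real N / c) ^ s / fact s * T ^ s)"
    using c d by (intro mult_left_mono sum_mono partial_sum_fps_power_le R x T) auto
  also have "(\<Sum>s\<le>k. (real N / c) ^ s / fact s * T ^ s) = (\<Sum>s\<le>k. (T * real N / c) ^ s /\<^sub>R fact s)"
    by (intro sum.cong) (auto simp: power_mult_distrib power_divide field_simps)
  also have "?B * \<dots> \<le> ?B * exp (T * real N / c)"
    unfolding exp_def using c d T0
    by (intro mult_left_mono sum_le_suminf summable_exp_generic) auto
  finally show ?thesis by (simp add: G_def)
qed

subsection \<open>The growth rate of the decorations\<close>

lemma root_le_max_1:
  assumes "i > 0" "u \<ge> 0"
  shows "root i u \<le> max 1 u"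
proof (cases "u \<le> 1")
  case True
  then have "root i u \<le> root i 1" using assms by (intro real_root_le_mono) auto
  with assms show ?thesis by simp
next
  case False
  then have "root i u \<le> root i (u ^ i)"
    using assms by (intro real_root_le_mono self_le_power) auto
  also have "root i (u ^ i) = u"
    using assms by (intro real_root_power_cancel) auto
  finally show ?thesis by simp
qed

text \<open>At a point \<open>K\<close> inside the disc of convergence the terms
  \<open>m i / i! * K^i\<close> are bounded by some \<open>C\<close>, so their \<open>i\<close>-th
  roots are bounded by \<open>max 1 C\<close> uniformly in \<open>i\<close>. This makes the real
  supremum \<rho> a genuine upper bound.\<close>

lemma bdd_above_decorations:
  assumes "fps_conv_radius (M_egf m) > 0"
  shows "bdd_above ((\<lambda>i. root i (real (m i) / fact i)) ` {3..})"
proof -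
  obtain K where K: "0 < ereal K" "ereal K < fps_conv_radius (M_egf m)"
    using ereal_dense2[OF assms] by auto
  then have "summable (\<lambda>i. fps_nth (M_egf m) i * K ^ i)"
    by (intro summable_fps) auto
  then have "Bseq (\<lambda>i. fps_nth (M_egf m) i * K ^ i)"
    by (intro convergent_imp_Bseq summable_LIMSEQ_zero[THEN convergentI])
  then obtain C where C: "C > 0" "\<And>i. norm (fps_nth (M_egf m) i * K ^ i) \<le> C"
    by (auto elim: BseqE)
  have "root i (real (m i) / fact i) \<le> max 1 C / K" if "i \<ge> 3" for i
  proof -
    have "root i (real (m i) / fact i) * K = root i (real (m i) / fact i * K ^ i)"
      using that K by (simp only: real_root_mult) (simp add: real_root_power_cancel)
    also have "\<dots> \<le> max 1 (real (m i) / fact i * K ^ i)"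
      using that K by (intro root_le_max_1) auto
    also have "\<dots> \<le> max 1 C"
      using C(2)[of i] that K by (simp add: M_egf_def)
    finally show ?thesis using K by (simp add: field_simps)
  qed
  then show ?thesis by (intro bdd_aboveI[where M = "max 1 C / K"]) auto
qed

lemma \<rho>_nonneg:
  assumes "fps_conv_radius (M_egf m) > 0"
  shows "\<rho> m \<ge> 0"
  unfolding \<rho>_def using bdd_above_decorations[OF assms]
  by (intro cSUP_upper2[of _ _ 3]) auto

lemma decorations_le_\<rho>_power:
  assumes "fps_conv_radius (M_egf m) > 0" "i \<ge> 3"
  shows "real (m i) / fact i \<le> \<rho> m ^ i"
proof -
  have "root i (real (m i) / fact i) \<le> \<rho> m"
    unfolding \<rho>_def using bdd_above_decorations[OF assms(1)] assms(2)
    by (intro cSUP_upper) auto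
  then have "root i (real (m i) / fact i) ^ i \<le> \<rho> m ^ i"
    using assms(2) by (intro power_mono) (auto intro!: real_root_ge_zero)
  with assms(2) show ?thesis by simp
qed

subsection \<open>Comparison with the main term\<close>

text \<open>This is the series \<open>R\<close> of the overview. One factor of the variable is
  pulled out, so degree \<open>i\<close> belongs to components of size \<open>i + 1\<close>, and
  sizes from 3 on start at degree 2.\<close>

definition egf_tail :: "(nat \<Rightarrow> nat) \<Rightarrow> real fps" where
  "egf_tail m = Abs_fps (\<lambda>i. if i < 2 then 0 else real (m (Suc i)) / fact (Suc i))"

lemma M_egf_split:
  "M_egf m = fps_X * (egf_tail m + (fps_const (real (m 1)) + fps_const (real (m 2) / 2) * fps_X))"
proof (rule fps_ext)
  fix i
  consider "i = 0" | "i = 1" | "i = 2" | j where "i = Suc (Suc (Suc j))"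
    by (metis One_nat_def Suc_1 not0_implies_Suc)
  then show "fps_nth (M_egf m) i = fps_nth (fps_X *
      (egf_tail m + (fps_const (real (m 1)) + fps_const (real (m 2) / 2) * fps_X))) i"
    by cases (simp_all add: M_egf_def egf_tail_def numeral_2_eq_2)
qed

text \<open>Each of the \<open>N + r\<close> factors of the power contributes one
  \<open>fps_X\<close>, which lowers the degree from \<open>N + 2 * r\<close> to \<open>r\<close>.
  Parametrising by \<open>N\<close> and \<open>r\<close> also avoids natural subtraction.\<close>

lemma p_eq_coeff:
  "real (p m (N + 2 * r) (N + r)) = fact (N + 2 * r) / fact (N + r) * fps_nth
     ((egf_tail m + (fps_const (real (m 1)) + fps_const (real (m 2) / 2) * fps_X)) ^ (N + r)) r"
  (is "_ = _ / _ * fps_nth (?F ^ _) r")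
proof -
  have "fps_nth (M_egf m ^ (N + r)) (N + 2 * r) = fps_nth (?F ^ (N + r)) r"
    unfolding M_egf_split power_mult_distrib fps_X_power_mult_nth by simp
  with fact_mult_p[of "N + r" m "N + 2 * r"] show ?thesis
    by (simp only: eq_divide_eq times_divide_eq_left) (simp add: mult_ac)
qed

lemma falling_eq_fact_div:
  assumes "j \<le> n"
  shows "falling n j = fact n / fact (n - j)"
  using assms
proof (induction j)
  case (Suc j)
  have "n - j = Suc (n - Suc j)" using Suc.prems by simp
  then have "fact (n - j) = (real n - real j) * fact (n - Suc j)"
    using Suc.prems by (metis Suc_leD fact_Suc of_nat_diff)
  with Suc show ?case by (simp add: falling_def)
qed (simp add: falling_def)

text \<open>The factor in parentheses is the coefficient of degree \<open>r\<close> in the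
  \<open>(N + r)\<close>-th power of the linear part of \<open>M_egf m\<close> divided by
  \<open>fps_X\<close>.\<close>

lemma main_term_eq:
  "main_term m (N + 2 * r) r = fact (N + 2 * r) / fact (N + r) *
     (real ((N + r) choose r) * real (m 1) ^ N * (real (m 2) / 2) ^ r)"
  by (simp add: main_term_def falling_eq_fact_div binomial_fact power_divide field_simps)

lemma p_trunc_decorations:
  "real (p (trunc_decorations m) (N + 2 * r) (N + r)) = main_term m (N + 2 * r) r"
proof -
  have "egf_tail (trunc_decorations m) = 0"
    by (rule fps_ext) (simp add: egf_tail_def trunc_decorations_def)
  then show ?thesis
    by (simp only: p_eq_coeff main_term_eq add_0_left fps_nth_linear_power)
       (simp add: trunc_decorations_def mult_ac)
qed

lemma sum_half_powers_from_3_le: "(\<Sum>i\<le>r. if i < 3 then 0 else (1 / 2) ^ (i - 3)) \<le> (2 :: real)"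
proof -
  \<comment> \<open>The range is lengthened so that the closed form of the geometric sum already
    holds at \<open>r = 0\<close>, where all terms vanish.\<close>
  have eq: "(\<Sum>i<r + 3. if i < 3 then 0 else (1 / 2) ^ (i - 3)) = 2 - 2 * (1 / 2 :: real) ^ r"
  proof (induction r)
    case 0
    show ?case by (simp add: numeral_3_eq_3)
  next
    case (Suc r)
    have "{..<Suc r + 3} = insert (r + 3) {..<r + 3}" by auto
    with Suc show ?case by simp
  qed
  have "(\<Sum>i\<le>r. if i < 3 then 0 else (1 / 2 :: real) ^ (i - 3)) \<le>
      (\<Sum>i<r + 3. if i < 3 then 0 else (1 / 2) ^ (i - 3))"
    by (intro sum_mono2) auto
  also have "\<dots> \<le> 2" unfolding eq by simp
  finally show ?thesis .
qed

text \<open>The degree 2 term is kept exactly, as it yields \<open>y\<close>. From degree 3 on, the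
  terms are at most \<rho>^4 x^3 (x \<rho>)^(i - 3), a geometric series of ratio at most 1/2 and
  hence of sum at most twice its first term.\<close>

lemma egf_tail_partial_sum_le:
  assumes radius: "fps_conv_radius (M_egf m) > 0" and x: "0 \<le> x" "x * \<rho> m \<le> 1 / 2"
  shows "(\<Sum>i\<le>r. fps_nth (egf_tail m) i * x ^ i) \<le> real (m 3) / 6 * x ^ 2 + 2 * \<rho> m ^ 4 * x ^ 3"
proof -
  note \<rho>0 = \<rho>_nonneg[OF radius]
  have "fps_nth (egf_tail m) i * x ^ i \<le> (if i = 2 then real (m 3) / 6 * x ^ 2 else 0) +
      \<rho> m ^ 4 * x ^ 3 * (if i < 3 then 0 else (1 / 2) ^ (i - 3))" for i
  proof -
    consider "i < 2" | "i = 2" | "i \<ge> 3" by linarith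
    then show ?thesis
    proof cases
      case 3
      then have "real (m (Suc i)) / fact (Suc i) * x ^ i \<le> \<rho> m ^ Suc i * x ^ i"
        using x by (intro mult_right_mono decorations_le_\<rho>_power radius) auto
      also have "\<dots> = \<rho> m ^ 4 * x ^ 3 * (x * \<rho> m) ^ (i - 3)"
      proof -
        obtain j where "i = j + 3" using 3 le_Suc_ex by (metis add.commute)
        then show ?thesis by (simp add: power_mult_distrib power_add eval_nat_numeral)
      qed
      also have "\<dots> \<le> \<rho> m ^ 4 * x ^ 3 * (1 / 2) ^ (i - 3)"
        using x \<rho>0 by (intro mult_left_mono power_mono) auto
      finally show ?thesis using 3 by (simp add: egf_tail_def)
    qed (simp_all add: egf_tail_def eval_nat_numeral)
  qed
  then have "(\<Sum>i\<le>r. fps_nth (egf_tail m) i * x ^ i) \<le>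
      (\<Sum>i\<le>r. (if i = 2 then real (m 3) / 6 * x ^ 2 else 0) +
        \<rho> m ^ 4 * x ^ 3 * (if i < 3 then 0 else (1 / 2) ^ (i - 3)))"
    by (rule sum_mono)
  also have "\<dots> = (if 2 \<le> r then real (m 3) / 6 * x ^ 2 else 0) +
      \<rho> m ^ 4 * x ^ 3 * (\<Sum>i\<le>r. if i < 3 then 0 else (1 / 2) ^ (i - 3))"
    by (simp add: sum.distrib sum_distrib_left)
  also have "\<dots> \<le> real (m 3) / 6 * x ^ 2 + \<rho> m ^ 4 * x ^ 3 * 2"
    using x \<rho>0 by (intro add_mono mult_left_mono sum_half_powers_from_3_le) auto
  finally show ?thesis by (simp add: mult_ac)
qed

text \<open>From \<open>1 - W \<le> exp (- W)\<close>. It makes the effect of \<open>W\<close>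
  additive, matching the shape of \<open>z_par\<close>.\<close>

lemma exp_add_minus_le:
  fixes y W :: real
  assumes "0 \<le> W" "y + W \<le> 1"
  shows "exp (y + W) - exp y \<le> W * exp 1"
proof -
  have "exp (y + W) * (1 - W) \<le> exp (y + W) * exp (- W)"
    using exp_ge_add_one_self[of "- W"] by (intro mult_left_mono) auto
  also have "\<dots> = exp y" by (simp flip: exp_add)
  finally have "exp (y + W) - exp y \<le> W * exp (y + W)" by (simp add: algebra_simps)
  also have "\<dots> \<le> W * exp 1" using assms by (intro mult_left_mono) auto
  finally show ?thesis .
qed

lemma p_le_main_term:
  fixes m :: "nat \<Rightarrow> nat" and N r :: nat
  defines "n \<equiv> N + 2 * r"
  assumes m: "m 1 > 0" "m 2 > 0" and radius: "fps_conv_radius (M_egf m) > 0"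
    and N: "N > 0" and r: "r > 0"
    and x\<rho>: "x_par m n r * \<rho> m \<le> 1 / 2"
    and small: "2 * real (N + r) * \<rho> m ^ 3 * x_par m n r ^ 2 / real (m 1) \<le> 1 / 2"
  shows "real (p m n (N + r)) \<le> main_term m n r * (1 + z_par m n r)"
proof -
  define x where "x = x_par m n r"
  define y where "y = y_par m n r"
  define W where "W = 2 * \<rho> m ^ 4 * x ^ 3 * real N / real (m 1)"
  define T where "T = real (m 3) / 6 * x ^ 2 + 2 * \<rho> m ^ 4 * x ^ 3"
  note \<rho>0 = \<rho>_nonneg[OF radius]
  have x_eq: "x = real (m 1) * real r / (real (m 2) / 2 * real N)"
    by (simp add: x_def x_par_def n_def)
  have x0: "x \<ge> 0" by (simp add: x_eq)
  have y_eq: "y = real (m 3) / 6 * x ^ 2 * real N / real (m 1)"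
    using m N unfolding y_def y_par_def x_eq n_def
    by (simp add: power2_eq_square field_simps)
  have T_eq: "T * real N / real (m 1) = y + W"
    using m by (simp add: T_def y_eq W_def field_simps)
  have y0: "y \<ge> 0" and W0: "W \<ge> 0" using x0 \<rho>0 by (auto simp: y_eq W_def)
  \<comment> \<open>The quantity of the hypothesis \<open>small\<close>. It controls both parts of
    the exponent: \<open>y\<close> is at most \<open>q / 2\<close>, and \<open>W\<close> is at most
    \<open>q\<close> times \<open>x * \<rho> m\<close>.\<close>
  define q where "q = 2 * real (N + r) * \<rho> m ^ 3 * x ^ 2 / real (m 1)"
  have q: "0 \<le> q" "q \<le> 1 / 2" using small \<rho>0 by (auto simp: q_def x_def)
  have "real (m 3) / 6 \<le> \<rho> m ^ 3"
    using decorations_le_\<rho>_power[OF radius, of 3] by (simp add: fact_numeral)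
  then have "y \<le> \<rho> m ^ 3 * x ^ 2 * real (N + r) / real (m 1)"
    unfolding y_eq using \<rho>0 by (intro divide_right_mono mult_mono) auto
  also have "\<dots> = q / 2" using m by (simp add: q_def field_simps)
  finally have "y \<le> 1 / 4" using q by simp
  have "W \<le> 2 * \<rho> m ^ 4 * x ^ 3 * real (N + r) / real (m 1)"
    unfolding W_def using x0 \<rho>0 by (intro divide_right_mono mult_left_mono) auto
  also have "\<dots> = q * (x * \<rho> m)" by (simp add: q_def eval_nat_numeral)
  also have "\<dots> \<le> 1 / 2 * (1 / 2)"
    using q x\<rho> x0 \<rho>0 by (intro mult_mono) (auto simp: x_def)
  finally have "W \<le> 1 / 4" by simp
  have "exp (y + W) - exp y \<le> W * exp 1"
    using W0 \<open>y \<le> 1 / 4\<close> \<open>W \<le> 1 / 4\<close> by (intro exp_add_minus_le) auto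
  also have "W * exp 1 \<le> u4 m n r"
  proof -
    \<comment> \<open>The constant \<open>c0\<close> cancels the factor
      \<open>sqrt (2 * pi)\<close>, and \<open>r \<ge> 1\<close> leaves at least
      \<open>exp 1\<close>.\<close>
    have "c0 * sqrt (2 * pi * real r) = exp 1 * sqrt (real r)"
      by (simp add: c0_def real_sqrt_mult)
    moreover have "exp 1 * 1 \<le> exp (1 :: real) * sqrt (real r)"
      using r by (intro mult_left_mono) auto
    ultimately have "exp 1 \<le> c0 * sqrt (2 * pi * real r)" by simp
    with exp_gt_zero[of "1 :: real"] have e: "exp 1 \<le> 2 * (c0 * sqrt (2 * pi * real r))" by linarith
    have "W * exp 1 \<le> (real (N + r) * (2 * \<rho> m ^ 4 * x ^ 3 / real (m 1))) *
        (2 * (c0 * sqrt (2 * pi * real r)))"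
    proof (intro mult_mono e)
      show "W \<le> real (N + r) * (2 * \<rho> m ^ 4 * x ^ 3 / real (m 1))"
        using \<open>W \<le> 2 * \<rho> m ^ 4 * x ^ 3 * real (N + r) / real (m 1)\<close> by (simp add: mult_ac)
    qed (use x0 \<rho>0 in auto)
    then show ?thesis by (simp add: u4_def x_def n_def mult.assoc add.commute)
  qed
  finally have exp_le: "exp (y + W) \<le> 1 + z_par m n r" by (simp add: z_par_def y_def)
  define C where "C = real ((N + r) choose r) * real (m 1) ^ N * (real (m 2) / 2) ^ r"
  have C: "C \<ge> 0" by (simp add: C_def)
  have "fps_nth ((egf_tail m + (fps_const (real (m 1)) + fps_const (real (m 2) / 2) * fps_X)) ^ (N + r)) r
      \<le> C * exp (T * real N / real (m 1))"
    unfolding C_def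
  proof (rule fps_nth_power_linear_plus_le)
    show "(\<Sum>i\<le>r. fps_nth (egf_tail m) i *
        (real (m 1) * real r / (real (m 2) / 2 * real N)) ^ i) \<le> T"
      using egf_tail_partial_sum_le[OF radius x0] x\<rho> unfolding x_eq[symmetric] T_def x_def by simp
  qed (use m N in \<open>auto simp: egf_tail_def\<close>)
  also have "\<dots> \<le> C * (1 + z_par m n r)"
    unfolding T_eq using C by (intro mult_left_mono exp_le) auto
  finally have "fact n / fact (N + r) * fps_nth ((egf_tail m + (fps_const (real (m 1))
      + fps_const (real (m 2) / 2) * fps_X)) ^ (N + r)) r
      \<le> fact n / fact (N + r) * (C * (1 + z_par m n r))"
    by (intro mult_left_mono) auto
  then show ?thesis by (simp add: n_def p_eq_coeff main_term_eq C_def mult.assoc)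
qed

text \<open>The assemblies without large components number exactly \<open>main_term\<close>, so
  those with one are the excess of \<open>p\<close> over it. The excess is at most
  \<open>z_par\<close> times \<open>main_term\<close>, hence at most \<open>z_par\<close> times
  \<open>p\<close>.\<close>

lemma large_component_bounds:
  fixes m :: "nat \<Rightarrow> nat" and N r :: nat
  defines "n \<equiv> N + 2 * r"
  assumes m: "m 1 > 0" "m 2 > 0" and radius: "fps_conv_radius (M_egf m) > 0"
    and N: "N > 0" and r: "r > 0"
    and x\<rho>: "x_par m n r * \<rho> m \<le> 1 / 2"
    and small: "2 * real (N + r) * \<rho> m ^ 3 * x_par m n r ^ 2 / real (m 1) \<le> 1 / 2"
  shows "measure_pmf.prob (pmf_of_set (assemblies_with m n (N + r)))
           {a. largest_component a \<ge> 3} \<le> z_par m n r"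
    and "main_term m n r \<le> real (p m n (N + r))"
    and "z_par m n r < 1 \<Longrightarrow> real (p m n (N + r)) \<le>
           main_term m n r * (1 + z_par m n r / (1 - z_par m n r))"
proof -
  let ?z = "z_par m n r"
  let ?P = "measure_pmf.prob (pmf_of_set (assemblies_with m n (N + r))) {a. largest_component a \<ge> 3}"
  let ?S = "assemblies_with m n (N + r)" and ?L = "{a. largest_component a \<ge> 3}"
  have upper: "real (p m n (N + r)) \<le> main_term m n r * (1 + ?z)"
    unfolding n_def using assms by (intro p_le_main_term) auto
  have main_pos: "main_term m n r > 0" using m by (simp add: n_def main_term_eq)
  have fin: "finite ?S" by (simp add: assemblies_with_eq finite_assemblies_on)
  have "?S - ?L = assemblies_with (trunc_decorations m) n (N + r)"
    using N by (subst assemblies_with_trunc_decorations) (auto simp: n_def)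
  then have "real (card (?S - ?L)) = main_term m n r"
    using p_trunc_decorations[of m N r] by (simp add: p_def n_def)
  moreover have "card ?S = card (?S \<inter> ?L) + card (?S - ?L)"
    using fin by (metis Int_Diff_Un Int_Diff_disjoint card_Un_disjoint finite_Diff finite_Int)
  ultimately have p_eq: "real (p m n (N + r)) = real (card (?S \<inter> ?L)) + main_term m n r"
    by (simp add: p_def)
  then show lower: "main_term m n r \<le> real (p m n (N + r))" by simp
  have p_pos: "real (p m n (N + r)) > 0" using lower main_pos by linarith
  \<comment> \<open>Nonnegativity of \<open>z_par\<close> is read off from the lower and upper
    bounds on \<open>p\<close>.\<close>
  have "main_term m n r * 1 \<le> main_term m n r * (1 + ?z)" using lower upper by simp
  then have z0: "?z \<ge> 0" using main_pos by simp
  have "?S \<noteq> {}" using p_pos by (auto simp: p_def)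
  then have "?P = real (card (?S \<inter> ?L)) / real (p m n (N + r))"
    using fin by (simp add: measure_pmf_of_set p_def)
  also have "\<dots> \<le> ?z"
  proof -
    have "real (card (?S \<inter> ?L)) \<le> ?z * main_term m n r"
      using p_eq upper by (simp add: algebra_simps)
    also have "\<dots> \<le> ?z * real (p m n (N + r))" using z0 lower by (intro mult_left_mono)
    finally show ?thesis using p_pos by (simp add: field_simps)
  qed
  finally show "?P \<le> ?z" .
  assume "?z < 1"
  \<comment> \<open>The factor \<open>1 + z\<close> already obtained is weakened to the stated
    one.\<close>
  then have "?z \<le> ?z / (1 - ?z)"
    using z0 by (simp add: le_divide_eq mult_left_le)
  then have "main_term m n r * (1 + ?z) \<le> main_term m n r * (1 + ?z / (1 - ?z))"
    using main_pos by (intro mult_left_mono) auto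
  with upper show "real (p m n (N + r)) \<le> main_term m n r * (1 + ?z / (1 - ?z))" by simp
qed

subsection \<open>Asymptotics of the error bound\<close>

text \<open>All comparisons reduce to \<open>r^2 / n\<close> tending to 0: it forces
  \<open>r / n\<close> and \<open>y\<close> to 0, and \<open>u4 / y\<close> is bounded by a constant
  times it.\<close>

lemma z_par_asymptotics:
  fixes m r :: "nat \<Rightarrow> nat"
  defines "C \<equiv> 2 * real (m 1) * real (m 3) / (3 * real (m 2) ^ 2)"
  assumes m: "m 1 > 0" "m 2 > 0" "m 3 > 0" and radius: "fps_conv_radius (M_egf m) > 0"
    and r: "\<forall>\<^sub>F n in at_top. 0 < r n \<and> real (r n) < real n / 2"
    and small: "(\<lambda>n. real (r n)) \<in> o[at_top](\<lambda>n. sqrt (real n))"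
  shows "(\<lambda>n. z_par m n (r n) / (1 - z_par m n (r n))) \<sim>[at_top] (\<lambda>n. z_par m n (r n))"
    and "(\<lambda>n. z_par m n (r n)) \<sim>[at_top] (\<lambda>n. y_par m n (r n))"
    and "(\<lambda>n. y_par m n (r n)) \<sim>[at_top] (\<lambda>n. C * (real (r n) ^ 2 / real n))"
proof -
  let ?y = "\<lambda>n. y_par m n (r n)" and ?z = "\<lambda>n. z_par m n (r n)"
  let ?u = "\<lambda>n. u4 m n (r n)" and ?s = "\<lambda>n. real (r n) ^ 2 / real n"
  have C: "C > 0" using m by (simp add: C_def)
  have s0: "?s \<longlonglongrightarrow> 0"
  proof -
    have "(\<lambda>n. real (r n) / sqrt (real n)) \<longlonglongrightarrow> 0" using small by (rule smalloD_tendsto)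
    then have "(\<lambda>n. (real (r n) / sqrt (real n)) ^ 2) \<longlonglongrightarrow> 0 ^ 2" by (rule tendsto_power)
    then show ?thesis by (simp add: power_divide)
  qed
  have q0: "(\<lambda>n. real (r n) / real n) \<longlonglongrightarrow> 0"
  proof (rule tendsto_sandwich[OF _ _ tendsto_const s0])
    show "\<forall>\<^sub>F n in at_top. real (r n) / real n \<le> ?s n"
    proof (intro always_eventually allI divide_right_mono)
      show "real (r n) \<le> real (r n) ^ 2" for n
        using self_le_power[of "real (r n)" 2] by (cases "r n = 0") auto
    qed auto
  qed auto
  have y_eq: "\<forall>\<^sub>F n in at_top. ?y n / (C * ?s n) = 1 / (1 - 2 * (real (r n) / real n))"
    using r
  proof eventually_elim
    case (elim n)
    then show ?case using C by (simp only: y_par_def C_def[symmetric]) (simp add: field_simps)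
  qed
  have "(\<lambda>n. 1 / (1 - 2 * (real (r n) / real n))) \<longlonglongrightarrow> 1 / (1 - 2 * 0)"
    by (intro tendsto_intros q0) auto
  then have "(\<lambda>n. ?y n / (C * ?s n)) \<longlonglongrightarrow> 1"
    using y_eq by (subst tendsto_cong) auto
  then show y_asymp: "?y \<sim>[at_top] (\<lambda>n. C * ?s n)" by (rule asymp_equivI')
  have y_pos: "\<forall>\<^sub>F n in at_top. ?y n > 0"
    using r by eventually_elim (use m in \<open>auto simp: y_par_def intro!: divide_pos_pos mult_pos_pos\<close>)
  have "(\<lambda>n. C * ?s n) \<longlonglongrightarrow> 0" using tendsto_mult_left[OF s0, of C] by simp
  then have y0: "?y \<longlonglongrightarrow> 0" using asymp_equiv_tendsto_transfer[OF asymp_equiv_symI[OF y_asymp]] by blast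
  \<comment> \<open>The derivative of \<open>exp\<close> at 0, composed with \<open>y\<close>; the
    punctured limit applies since \<open>y\<close> is eventually positive.\<close>
  have exp_y: "(\<lambda>n. (exp (?y n) - 1) / ?y n) \<longlonglongrightarrow> 1"
  proof -
    have "((\<lambda>h :: real. (exp h - 1) / h) \<longlongrightarrow> 1) (at 0)" by (rule lim_exp_minus_1)
    moreover have "filterlim ?y (at 0) at_top"
      using y0 y_pos by (auto simp: filterlim_at elim: eventually_mono)
    ultimately show ?thesis by (rule filterlim_compose)
  qed
  \<comment> \<open>Collects the factors of \<open>u4 / y\<close> that do not depend on
    \<open>n\<close>, once \<open>x_par\<close> is split into \<open>2 * m 1 / m 2\<close> and
    \<open>r / (n - 2 r)\<close>.\<close>
  define D where "D = 2 * \<rho> m ^ 4 * (2 * real (m 1) / real (m 2)) ^ 3 / real (m 1) * (2 * exp 1) / C"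
  have D: "D \<ge> 0" using C \<rho>_nonneg[OF radius] by (simp add: D_def)
  \<comment> \<open>Eventually \<open>r / n < 1 / 4\<close>, so \<open>n - 2 r \<ge> n / 2\<close>;
    squaring this in the denominator produces the 4 in \<open>u_bounds\<close>.\<close>
  have quarter: "0 < (1 / 4 :: real)" by simp
  have u_bounds: "\<forall>\<^sub>F n in at_top. 0 \<le> ?u n / ?y n \<and> ?u n / ?y n \<le> 4 * D * ?s n"
    using r y_pos tendstoD[OF q0 quarter]
  proof eventually_elim
    case (elim n)
    let ?r = "real (r n)" and ?N = "real n - 2 * real (r n)"
    have N: "?N > 0" and rn: "0 < ?r" "?r < real n" using elim by auto
    have n4: "real n / 2 \<le> ?N" using elim(3) rn by (simp add: dist_real_def field_simps)
    have rk: "real (n - r n) = real n - ?r" using rn by simp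
    have "c0 * sqrt (2 * pi * ?r) = exp 1 * sqrt ?r" by (simp add: c0_def real_sqrt_mult)
    then have "?u n = (real n - ?r) * (2 * \<rho> m ^ 4 * x_par m n (r n) ^ 3 / real (m 1)) * (2 * exp 1 * sqrt ?r)"
      unfolding u4_def rk by (simp add: mult.assoc)
    also have "\<dots> = D * C * ((real n - ?r) * ?r ^ 3 * sqrt ?r / ?N ^ 3)"
      using C m by (simp add: D_def x_par_def power_mult_distrib power_divide mult_ac)
    finally have u: "?u n = D * C * ((real n - ?r) * ?r ^ 3 * sqrt ?r / ?N ^ 3)" .
    have y: "?y n = C * (?r ^ 2 / ?N)" by (simp add: y_par_def C_def)
    have uy: "?u n / ?y n = D * ((real n - ?r) * (?r * sqrt ?r) / ?N ^ 2)"
    proof -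
      have "D * C * (a * b ^ 3 * w / c ^ 3) / (C * (b ^ 2 / c)) = D * (a * (b * w) / c ^ 2)"
        if "b > 0" "c > 0" for a b c w :: real
        using C that by (simp add: field_simps eval_nat_numeral)
      from this[OF rn(1) N] show ?thesis unfolding u y .
    qed
    have "sqrt ?r \<le> ?r"
      using rn by (intro real_le_lsqrt) (auto simp: self_le_power)
    then have "(real n - ?r) * (?r * sqrt ?r) / ?N ^ 2 \<le> real n * (?r * ?r) / (real n / 2) ^ 2"
      using rn n4 by (intro frac_le mult_mono power_mono) auto
    also have "\<dots> = 4 * ?s n" using rn by (simp add: field_simps power2_eq_square)
    finally have "?u n / ?y n \<le> D * (4 * ?s n)" unfolding uy using D by (intro mult_left_mono)
    moreover have "0 \<le> ?u n / ?y n" unfolding uy using D rn by auto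
    ultimately show ?case by (simp add: mult_ac)
  qed
  have "(\<lambda>n. 4 * D * ?s n) \<longlonglongrightarrow> 0" using tendsto_mult_left[OF s0, of "4 * D"] by simp
  then have u_y: "(\<lambda>n. ?u n / ?y n) \<longlonglongrightarrow> 0"
    using u_bounds unfolding eventually_conj_iff
    by (elim conjE) (rule tendsto_sandwich[OF _ _ tendsto_const])
  have "(\<lambda>n. ?z n / ?y n) \<longlonglongrightarrow> 1"
    using tendsto_add[OF exp_y u_y] by (simp add: z_par_def add_divide_distrib)
  then show z_asymp: "?z \<sim>[at_top] ?y" by (rule asymp_equivI')
  have z0: "?z \<longlonglongrightarrow> 0"
    using asymp_equiv_tendsto_transfer[OF asymp_equiv_symI[OF z_asymp] y0] .
  have "(\<lambda>n. 1 - ?z n) \<longlonglongrightarrow> 1 - 0" by (intro tendsto_intros z0)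
  then have "(\<lambda>n. 1 - ?z n) \<sim>[at_top] (\<lambda>_. 1)" by (intro asymp_equivI') simp
  from asymp_equiv_divide[OF asymp_equiv_refl this]
  show "(\<lambda>n. ?z n / (1 - ?z n)) \<sim>[at_top] ?z" by simp
qed

theorem theorem3p13:
  fixes m :: "nat \<Rightarrow> nat"
  assumes m1: "m 1 > 0" and m2: "m 2 > 0"
    and radius: "fps_conv_radius (M_egf m) > 0"
  shows
    "(\<forall>n r :: nat. 0 < r \<longrightarrow> real r < real n / 2 \<longrightarrow>
        x_par m n r * \<rho> m \<le> 1 / 2 \<longrightarrow>
        2 * real (n - r) * \<rho> m ^ 3 * x_par m n r ^ 2 / real (m 1) \<le> 1 / 2 \<longrightarrow>
          measure_pmf.prob (pmf_of_set (assemblies_with m n (n - r)))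
            {a. largest_component a \<ge> 3} \<le> z_par m n r
        \<and> (z_par m n r < 1 \<longrightarrow>
            main_term m n r \<le> real (p m n (n - r))
          \<and> real (p m n (n - r))
              \<le> main_term m n r * (1 + z_par m n r / (1 - z_par m n r))))
   \<and> (m 3 > 0 \<longrightarrow>
       (\<forall>r :: nat \<Rightarrow> nat.
          (\<forall>\<^sub>F n in at_top. 0 < r n \<and> real (r n) < real n / 2) \<longrightarrow>
          (\<lambda>n. real (r n)) \<in> o[at_top](\<lambda>n. sqrt (real n)) \<longrightarrow>
            (\<lambda>n. z_par m n (r n) / (1 - z_par m n (r n))) \<sim>[at_top] (\<lambda>n. z_par m n (r n))
          \<and> (\<lambda>n. z_par m n (r n)) \<sim>[at_top] (\<lambda>n. y_par m n (r n))
          \<and> (\<lambda>n. y_par m n (r n)) \<sim>[at_top]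
              (\<lambda>n. 2 * real (m 1) * real (m 3) / (3 * real (m 2) ^ 2) * (real (r n) ^ 2 / real n))
          \<and> (\<lambda>n. 2 * real (m 1) * real (m 3) / (3 * real (m 2) ^ 2) * (real (r n) ^ 2 / real n))
              \<in> \<Theta>[at_top](\<lambda>n. real (r n) ^ 2 / real n)))"
proof (intro conjI allI impI; (elim conjE)?)
  fix n r :: nat
  assume r: "0 < r" and rn: "real r < real n / 2"
    and x: "x_par m n r * \<rho> m \<le> 1 / 2"
      "2 * real (n - r) * \<rho> m ^ 3 * x_par m n r ^ 2 / real (m 1) \<le> 1 / 2"
  \<comment> \<open>The bound \<open>r < n / 2\<close> makes \<open>N\<close> positive, and
    rewriting \<open>n\<close> and \<open>n - r\<close> by \<open>N\<close> brings the hypotheses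
    into the subtraction-free form of the bounds.\<close>
  define N where "N = n - 2 * r"
  have N: "N > 0" and n: "n = N + 2 * r" and k: "n - r = N + r"
    using rn by (auto simp: N_def)
  note bounds = large_component_bounds[OF m1 m2 radius N r x[unfolded k, unfolded n],
      folded n, folded k]
  show "measure_pmf.prob (pmf_of_set (assemblies_with m n (n - r)))
      {a. largest_component a \<ge> 3} \<le> z_par m n r"
    by (rule bounds(1))
  show "main_term m n r \<le> real (p m n (n - r))"
    by (rule bounds(2))
  assume "z_par m n r < 1"
  then show "real (p m n (n - r)) \<le> main_term m n r * (1 + z_par m n r / (1 - z_par m n r))"
    by (rule bounds(3))
next
  fix r :: "nat \<Rightarrow> nat"
  assume m3: "m 3 > 0"
    and r: "\<forall>\<^sub>F n in at_top. 0 < r n \<and> real (r n) < real n / 2"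
      "(\<lambda>n. real (r n)) \<in> o[at_top](\<lambda>n. sqrt (real n))"
  note asymp = z_par_asymptotics[OF m1 m2 m3 radius r]
  show "(\<lambda>n. z_par m n (r n) / (1 - z_par m n (r n))) \<sim>[at_top] (\<lambda>n. z_par m n (r n))"
    by (rule asymp(1))
  show "(\<lambda>n. z_par m n (r n)) \<sim>[at_top] (\<lambda>n. y_par m n (r n))"
    by (rule asymp(2))
  show "(\<lambda>n. y_par m n (r n)) \<sim>[at_top]
      (\<lambda>n. 2 * real (m 1) * real (m 3) / (3 * real (m 2) ^ 2) * (real (r n) ^ 2 / real n))"
    by (rule asymp(3))
  show "(\<lambda>n. 2 * real (m 1) * real (m 3) / (3 * real (m 2) ^ 2) * (real (r n) ^ 2 / real n))
      \<in> \<Theta>[at_top](\<lambda>n. real (r n) ^ 2 / real n)"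
    using m1 m2 m3 by (subst landau_theta.cmult_in_iff) auto
qed

end
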